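(* Let $k\ge 2$ be an integer. The equation $$4(1-r)-r^{k-1}(1-2r+5r^2)=0$$ has a unique root in $(0,1)$; denote it by $R_k$. For every $f\in\mathcal{B}_k$ with expansion $f(z)=\sum_{n=k}^{\infty}a_nz^n$, the inequality $$\sum_{n=k}^{\infty}|a_n|r^n+\left(\frac{r^{-k}}{1+|a_k|}+\frac{r^{1-k}}{1-r}\right)\sum_{n=k+1}^{\infty}|a_n|^2r^{2n}\le 1$$ holds for all $r\in[0,R_k]$. The upper bound $R_k$ cannot be improved, i.e. $R_k$ cannot be replaced by any larger number $R<1$: for every $R\in(R_k,1)$ there exist $f\in\mathcal{B}_k$ and $r\in[0,R]$ for which the inequality fails.
   Context: $\mathbb{D}=\{z\in\mathbb{C}:|z|<1\}$ is the open unit disk. $\mathcal{B}$ denotes the class of all analytic functions $f$ on $\mathbb{D}$ with $|f(z)|\le 1$ for all $z\in\mathbb{D}$. For $k\in\mathbb{N}$ (positive integers), $\mathcal{B}_k=\{f\in\mathcal{B}: f(0)=\cdots=f^{(k-1)}(0)=0\}$, so each $f\in\mathcal{B}_k$ has a power series $f(z)=\sum_{n=k}^\infty a_nz^n$ on $\mathbb{D}$. Convention: products such as $r^{-k}r^{2n}$ and $r^{1-k}r^{2n}$ are read as $r^{2n-k}$ and $r^{2n+1-k}$, so the left-hand side of the inequality equals $0$ at $r=0$. *)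

theory Defs
  imports "HOL-Complex_Analysis.Complex_Analysis"
begin

definition schur_class :: "(complex \<Rightarrow> complex) set" where
  "schur_class = {f. f analytic_on ball 0 1 \<and> (\<forall>z\<in>ball 0 1. norm (f z) \<le> 1)}"

definition schur_class_vanishing :: "nat \<Rightarrow> (complex \<Rightarrow> complex) set" where
  "schur_class_vanishing k = {f \<in> schur_class. \<forall>j<k. (deriv ^^ j) f 0 = 0}"

text \<open>
  Only the coefficients \<open>a n\<close> with \<open>n \<ge> k\<close> are constrained; the others occur nowhere below.
\<close>

definition expands_from :: "nat \<Rightarrow> (complex \<Rightarrow> complex) \<Rightarrow> (nat \<Rightarrow> complex) \<Rightarrow> bool" where
  "expands_from k f a \<longleftrightarrow> (\<forall>z\<in>ball 0 1. (\<lambda>n. a (n + k) * z ^ (n + k)) sums f z)"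

definition is_bohr_root :: "nat \<Rightarrow> real \<Rightarrow> bool" where
  "is_bohr_root k r \<longleftrightarrow>
     0 < r \<and> r < 1 \<and> 4 * (1 - r) - r ^ (k - 1) * (1 - 2 * r + 5 * r\<^sup>2) = 0"

definition bohr_radius :: "nat \<Rightarrow> real" where
  "bohr_radius k = (THE r. is_bohr_root k r)"

text \<open>
  The sums over \<open>n \<ge> k\<close> and \<open>n \<ge> k + 1\<close> are index-shifted. Under \<open>expands_from k f a\<close> and
  \<open>0 \<le> r < 1\<close> all of them converge, so \<open>suminf\<close> takes its genuine value. The negative powers
  of \<open>r\<close> are distributed into the sum, so that \<open>r\<close> occurs with exponents \<open>2 * n - k\<close> and
  \<open>2 * n + 1 - k\<close>; as \<open>n \<ge> k + 1\<close>, these subtractions do not truncate. In particular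
  the value at \<open>r = 0\<close> is \<open>0\<close> for \<open>k \<ge> 1\<close>.
\<close>

definition bohr_lhs :: "nat \<Rightarrow> (nat \<Rightarrow> complex) \<Rightarrow> real \<Rightarrow> real" where
  "bohr_lhs k a r =
     (\<Sum>n. norm (a (n + k)) * r ^ (n + k))
     + (1 / (1 + norm (a k)) * (\<Sum>n. (norm (a (n + (k + 1))))\<^sup>2 * r ^ (2 * (n + (k + 1)) - k))
        + 1 / (1 - r) * (\<Sum>n. (norm (a (n + (k + 1))))\<^sup>2 * r ^ (2 * (n + (k + 1)) + 1 - k)))"

end

theory Submission
  imports Defs
begin

text \<open>
  Writing \<open>f(z) = z\<^sup>k g(z)\<close> with \<open>g(z) = \<Sum>b\<^sub>n z\<^sup>n\<close> and \<open>t = |b\<^sub>0|\<close>, Carlson's inequalities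
  \<open>|b\<^sub>M| \<le> 1 - |b\<^sub>0|\<^sup>2 - \<dots> - |b\<^sub>n|\<^sup>2\<close> for \<open>M = 2n+1\<close>, and the same with \<open>|b\<^sub>n|\<^sup>2\<close> divided by \<open>1 + t\<close> for
  \<open>M = 2n\<close>, add up to the bound \<open>r\<^sup>k (t + (1 - t\<^sup>2) r / (1 - r))\<close> of the left-hand side. Completing the
  square in \<open>t\<close> bounds this by \<open>r^(k-1) (1 - 2r + 5r\<^sup>2) / (4(1 - r))\<close>, attained at \<open>t = (1 - r) / (2r)\<close>.
  The first bound is an equality for \<open>g(z) = (t - z) / (1 - t z)\<close>, which gives sharpness because \<open>R\<^sub>k > 1/3\<close>
  makes the optimal \<open>t\<close> less than \<open>1\<close>. Carlson's inequalities follow by integrating \<open>g\<close>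
  against suitable squares of trigonometric polynomials.
\<close>

section \<open>Taylor coefficients as integrals over circles, and Parseval's identity\<close>

text \<open>Pointwise convergence on the disk forces radius of convergence at least 1, so
  \<open>c\<close> is the formal power series expansion of \<open>h\<close> at 0.\<close>

lemma higher_deriv_eq_coeff:
  fixes c :: "nat \<Rightarrow> complex"
  assumes "\<And>z. norm z < 1 \<Longrightarrow> (\<lambda>n. c n * z ^ n) sums h z"
  shows "(deriv ^^ n) h 0 = fact n * c n"
proof -
  have "ereal 1 \<le> fps_conv_radius (Abs_fps c)"
    unfolding fps_conv_radius_def
  proof (rule conv_radius_geI_ex)
    fix r :: real assume "0 < r" "ereal r < ereal 1"
    then show "\<exists>z. norm z = r \<and> summable (\<lambda>n. fps_nth (Abs_fps c) n * z ^ n)"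
      using assms[of "of_real r"] by (intro exI[of _ "of_real r"]) (auto simp: sums_iff)
  qed
  moreover have "eventually (\<lambda>z. eval_fps (Abs_fps c) z = h z) (nhds 0)"
    using assms by (auto simp: eventually_nhds_metric eval_fps_def sums_iff intro!: exI[of _ 1])
  ultimately have "h has_fps_expansion Abs_fps c"
    unfolding has_fps_expansion_def
    using less_le_trans[of 0 "ereal 1"] by auto
  from fps_nth_fps_expansion[OF this, of n] show ?thesis by simp
qed

text \<open>Cauchy's formula for the n-th derivative on the circle of radius \<open>\<rho>\<close>,
  multiplied by \<open>\<rho> ^ n / (2 * pi * \<i>)\<close>; on the unit circle conjugation is
  inversion.\<close>

lemma has_integral_circle_coeff:
  assumes h: "h holomorphic_on ball 0 1" and \<rho>: "0 < \<rho>" "\<rho> < 1"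
  shows "((\<lambda>t. h (of_real \<rho> * cis (2 * pi * t)) * cnj (cis (2 * pi * t)) ^ n) has_integral
           ((deriv ^^ n) h 0 / fact n * of_real \<rho> ^ n)) {0..1}"
proof -
  have "continuous_on (cball 0 \<rho>) h" "h holomorphic_on ball 0 \<rho>"
    using \<rho> by (auto intro!: holomorphic_on_imp_continuous_on holomorphic_on_subset[OF h])
  from Cauchy_has_contour_integral_higher_derivative_circlepath[OF this, of 0 n]
  have "((\<lambda>u. h u / u ^ Suc n) has_contour_integral
      (2 * pi * \<i> / fact n * (deriv ^^ n) h 0)) (circlepath 0 \<rho>)"
    using \<rho> by simp
  then have "((\<lambda>t. h (circlepath 0 \<rho> t) / circlepath 0 \<rho> t ^ Suc n * (2 * pi * \<i> * \<rho> * exp (2 * of_real pi * \<i> * t)))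
      has_integral (2 * pi * \<i> / fact n * (deriv ^^ n) h 0)) {0..1}"
    by (simp only: has_contour_integral vector_derivative_circlepath)
  from has_integral_mult_right[OF this, of "of_real \<rho> ^ n / (2 * pi * \<i>)"]
  have "((\<lambda>t. of_real \<rho> ^ n / (2 * pi * \<i>) * (h (circlepath 0 \<rho> t) / circlepath 0 \<rho> t ^ Suc n * (2 * pi * \<i> * \<rho> * exp (2 * of_real pi * \<i> * t))))
      has_integral ((deriv ^^ n) h 0 / fact n * of_real \<rho> ^ n)) {0..1}"
    by (simp add: field_simps)
  moreover have "of_real \<rho> ^ n / (2 * pi * \<i>) * (h (circlepath 0 \<rho> t) / circlepath 0 \<rho> t ^ Suc n * (2 * pi * \<i> * \<rho> * exp (2 * of_real pi * \<i> * t)))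
     = h (of_real \<rho> * cis (2 * pi * t)) * cnj (cis (2 * pi * t)) ^ n" for t
  proof -
    have e: "exp (2 * of_real pi * \<i> * t) = cis (2 * pi * t)"
      by (simp add: cis_conv_exp mult_ac)
    have c: "circlepath 0 \<rho> t = of_real \<rho> * cis (2 * pi * t)"
      by (simp add: circlepath e)
    have c': "cnj (cis (2 * pi * t)) = inverse (cis (2 * pi * t))"
      by (simp add: cis_cnj)
    have *: "x ^ n / p * (y / (x * w) ^ Suc n * (p * x * w)) = y * inverse w ^ n"
      if "x \<noteq> 0" "w \<noteq> 0" "p \<noteq> 0" for x y w p :: complex
      using that by (simp add: divide_simps power_mult_distrib)
    show ?thesis
      unfolding e c c' by (rule *) (use \<rho> in auto)
  qed
  ultimately show ?thesis by simp
qed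

text \<open>The circle formula asks for a radius below 1, so it is applied to
  \<open>(2 * u) ^ i\<close> at radius 1/2, where \<open>2 * u\<close> runs over the unit
  circle.\<close>

lemma has_integral_cis_orthogonal:
  "((\<lambda>t. cis (2 * pi * t) ^ i * cnj (cis (2 * pi * t)) ^ j) has_integral (if i = j then 1 else 0)) {0..1}"
proof -
  define c :: "nat \<Rightarrow> complex" where "c = (\<lambda>n. if n = i then 2 ^ i else 0)"
  have "(deriv ^^ j) (\<lambda>u. (2 * u) ^ i) 0 = fact j * c j"
  proof (rule higher_deriv_eq_coeff)
    fix z :: complex
    show "(\<lambda>n. c n * z ^ n) sums (2 * z) ^ i"
      using sums_single[of i "\<lambda>n. (2 * z) ^ n"]
      by (simp add: c_def power_mult_distrib if_distrib[of "\<lambda>x. x * _"] cong: if_cong)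
  qed
  moreover have "((\<lambda>t. (2 * (of_real (1/2) * cis (2 * pi * t))) ^ i * cnj (cis (2 * pi * t)) ^ j) has_integral
           ((deriv ^^ j) (\<lambda>u. (2 * u) ^ i) 0 / fact j * of_real (1/2) ^ j)) {0..1}"
    by (rule has_integral_circle_coeff) (auto intro!: holomorphic_intros)
  ultimately show ?thesis
    by (simp add: c_def power_divide split: if_splits)
qed

text \<open>This evaluates the integral of the majorant in
  \<open>circle_coeff_inequality\<close>.\<close>

lemma Parseval_polynomial:
  fixes q :: "nat \<Rightarrow> complex"
  assumes "finite A"
  shows "((\<lambda>t. (norm (\<Sum>i\<in>A. q i * cis (2 * pi * t) ^ i))\<^sup>2) has_integral (\<Sum>i\<in>A. (norm (q i))\<^sup>2)) {0..1}"
proof -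
  let ?p = "\<lambda>t. \<Sum>i\<in>A. q i * cis (2 * pi * t) ^ i"
  have "((\<lambda>t. \<Sum>i\<in>A. \<Sum>j\<in>A. q i * cnj (q j) * (cis (2 * pi * t) ^ i * cnj (cis (2 * pi * t)) ^ j))
      has_integral (\<Sum>i\<in>A. \<Sum>j\<in>A. q i * cnj (q j) * (if i = j then 1 else 0))) {0..1}"
    by (intro has_integral_sum has_integral_mult_right has_integral_cis_orthogonal assms)
  moreover have "(\<Sum>i\<in>A. \<Sum>j\<in>A. q i * cnj (q j) * (if i = j then 1 else 0)) = of_real (\<Sum>i\<in>A. (norm (q i))\<^sup>2)"
    using assms by (simp add: if_distrib[of "\<lambda>x. _ * x"] complex_norm_square del: of_real_power cong: if_cong)
  moreover have "(\<Sum>i\<in>A. \<Sum>j\<in>A. q i * cnj (q j) * (cis (2 * pi * t) ^ i * cnj (cis (2 * pi * t)) ^ j)) = of_real ((norm (?p t))\<^sup>2)" for t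
    unfolding complex_norm_square cnj_sum sum_product by (simp add: mult_ac)
  ultimately have "((\<lambda>t. of_real ((norm (?p t))\<^sup>2)) has_integral (of_real (\<Sum>i\<in>A. (norm (q i))\<^sup>2) :: complex)) {0..1}"
    by simp
  from has_integral_linear[OF this bounded_linear_Re] show ?thesis by (simp add: o_def del: of_real_power)
qed

section \<open>Carlson's coefficient inequalities\<close>

text \<open>
  With \<open>Q(z) = \<Sum>v\<^sub>i z\<^sup>i\<close> and \<open>P(z) = z\<^sup>n cnj(Q(z))\<close> on the unit circle, a polynomial in \<open>z\<close>, one has
  \<open>\<eta> cnj(z)\<^sup>M + 2 cnj(Q) + cnj(\<eta>) z\<^sup>d P\<^sup>2 = \<eta> cnj(z)\<^sup>M (1 + cnj(\<eta>) z\<^sup>M cnj(Q))\<^sup>2\<close>, of modulus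
  \<open>|cnj(\<eta>) z\<^sup>M + Q|\<^sup>2\<close>. Integrate \<open>g(\<rho>z)\<close> against it.
\<close>
lemma circle_coeff_inequality:
  fixes b v :: "nat \<Rightarrow> complex"
  assumes g: "\<And>z. norm z < 1 \<Longrightarrow> (\<lambda>n. b n * z ^ n) sums g z"
    and \<rho>: "0 < \<rho>" "\<rho> < 1"
    and C: "\<And>z. norm z = \<rho> \<Longrightarrow> norm (g z) \<le> C"
    and M: "M = 2 * n + d" "n < M" and \<eta>: "norm \<eta> = 1"
  shows "norm (\<eta> * (b M * of_real \<rho> ^ M) + (\<Sum>i\<le>n. 2 * cnj (v i) * (b i * of_real \<rho> ^ i)) + cnj \<eta> * (b 0 * 0 ^ d * cnj (v n) ^ 2))
         \<le> C * (1 + (\<Sum>i\<le>n. (norm (v i))\<^sup>2))"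
proof -
  define E where "E = (\<lambda>t. cis (2 * pi * t))"
  define P where "P = (\<lambda>u. \<Sum>i\<le>n. cnj (v i) * u ^ (n - i))"
  have holg: "g holomorphic_on ball 0 1"
    using power_series_holomorphic[of 0 1 b g] g by simp
  have E1: "norm (E t) = 1" for t by (simp add: E_def)
  have E2: "E t * cnj (E t) = 1" for t
    using complex_norm_square[of "E t"] E1[of t] by simp
  have gi: "((\<lambda>t. g (of_real \<rho> * E t) * cnj (E t) ^ i) has_integral b i * of_real \<rho> ^ i) {0..1}" for i
    using has_integral_circle_coeff[OF holg \<rho>, of i] higher_deriv_eq_coeff[OF g, where n = i]
    by (simp add: E_def)
  \<comment> \<open>Dividing by \<open>\<rho>\<close> undoes the scaling of the circle. The function
    is holomorphic, so its mean is its value at 0, where \<open>0 ^ d\<close> is 1 for d = 0 and 0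
    otherwise.\<close>
  let ?h = "\<lambda>u. g u * ((u / of_real \<rho>) ^ d * P (u / of_real \<rho>) ^ 2)"
  have "?h holomorphic_on ball 0 1"
    unfolding P_def using \<rho> by (intro holomorphic_intros holg) auto
  from has_integral_circle_coeff[OF this \<rho>, of 0]
  have "((\<lambda>t. g (of_real \<rho> * E t) * (E t ^ d * P (E t) ^ 2)) has_integral g 0 * (0 ^ d * P 0 ^ 2)) {0..1}"
    using \<rho> by (simp add: E_def)
  moreover have "g 0 = b 0" using g[of 0] by (simp add: sums_iff)
  moreover have "P 0 = cnj (v n)"
  proof -
    have "P 0 = (\<Sum>i\<le>n. if i = n then cnj (v i) else 0)"
      unfolding P_def by (intro sum.cong) auto
    then show ?thesis by simp
  qed
  ultimately have gP: "((\<lambda>t. g (of_real \<rho> * E t) * (E t ^ d * P (E t) ^ 2)) has_integral b 0 * 0 ^ d * cnj (v n) ^ 2) {0..1}"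
    by (simp add: mult_ac)
  let ?F = "\<lambda>t. \<eta> * (g (of_real \<rho> * E t) * cnj (E t) ^ M) + (\<Sum>i\<le>n. 2 * cnj (v i) * (g (of_real \<rho> * E t) * cnj (E t) ^ i))
     + cnj \<eta> * (g (of_real \<rho> * E t) * (E t ^ d * P (E t) ^ 2))"
  have F: "(?F has_integral \<eta> * (b M * of_real \<rho> ^ M) + (\<Sum>i\<le>n. 2 * cnj (v i) * (b i * of_real \<rho> ^ i)) + cnj \<eta> * (b 0 * 0 ^ d * cnj (v n) ^ 2)) {0..1}"
    by (intro has_integral_add has_integral_sum has_integral_mult_right gi gP) auto
  \<comment> \<open>Since M > n, the index M is free, and \<open>q\<close> is the coefficient
    sequence of the polynomial \<open>cnj \<eta> * z ^ M + Q\<close>, ready for Parseval.\<close>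
  define q where "q = (\<lambda>i. if i = M then cnj \<eta> else v i)"
  have q: "((\<lambda>t. C * (norm (\<Sum>i\<in>insert M {..n}. q i * E t ^ i))\<^sup>2) has_integral
      C * (\<Sum>i\<in>insert M {..n}. (norm (q i))\<^sup>2)) {0..1}"
    unfolding E_def by (intro has_integral_mult_right Parseval_polynomial) auto
  have qs: "(\<Sum>i\<in>insert M {..n}. (norm (q i))\<^sup>2) = 1 + (\<Sum>i\<le>n. (norm (v i))\<^sup>2)"
    using M \<eta> by (auto simp: q_def intro!: sum.cong)
  have bound: "norm (?F t) \<le> C * (norm (\<Sum>i\<in>insert M {..n}. q i * E t ^ i))\<^sup>2" for t
  proof -
    define Q where "Q = (\<Sum>i\<le>n. v i * E t ^ i)"
    have qQ: "(\<Sum>i\<in>insert M {..n}. q i * E t ^ i) = cnj \<eta> * E t ^ M + Q"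
      using M by (auto simp: q_def Q_def intro!: sum.cong)
    have En: "E t ^ m * cnj (E t) ^ m = 1" for m
      using E2[of t] by (metis power_mult_distrib power_one)
    have \<eta>1: "\<eta> * cnj \<eta> = 1"
      using complex_norm_square[of \<eta>] \<eta> by simp
    \<comment> \<open>To be used with x = g, y = \<open>cnj Q\<close>, e = \<open>E t ^ M\<close>
      and f = \<open>cnj (E t) ^ M\<close>: the integrand is g times a unimodular factor times a
      perfect square.\<close>
    have alg: "\<eta> * (x * f) + 2 * x * y + cnj \<eta> * (x * (e * y\<^sup>2)) = x * (cnj \<eta> * e) * (\<eta> * f + y)\<^sup>2"
      if "\<eta> * cnj \<eta> = 1" "e * f = 1" for x y e f
    proof -
      have "x * (cnj \<eta> * e) * (\<eta> * f + y)\<^sup>2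
          = (\<eta> * cnj \<eta>) * (e * f) * (\<eta> * (x * f) + 2 * x * y) + cnj \<eta> * (x * (e * y\<^sup>2))"
        by (simp add: power2_eq_square algebra_simps)
      then show ?thesis unfolding that by simp
    qed
    have "P (E t) = E t ^ n * cnj Q"
      unfolding P_def Q_def cnj_sum sum_distrib_left
    proof (intro sum.cong refl)
      fix i assume "i \<in> {..n}"
      then have "E t ^ n = E t ^ (n - i) * E t ^ i" by (simp flip: power_add)
      then show "cnj (v i) * E t ^ (n - i) = E t ^ n * cnj (v i * E t ^ i)"
        using En[of i] by (simp add: algebra_simps)
    qed
    then have "E t ^ d * P (E t) ^ 2 = E t ^ M * cnj Q ^ 2"
      by (simp add: M power_mult_distrib power_add mult_ac flip: power_mult)
    moreover have "(\<Sum>i\<le>n. 2 * cnj (v i) * (g (of_real \<rho> * E t) * cnj (E t) ^ i)) = 2 * g (of_real \<rho> * E t) * cnj Q"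
      by (simp add: Q_def sum_distrib_left mult_ac)
    ultimately have "?F t = g (of_real \<rho> * E t) * (cnj \<eta> * E t ^ M) * cnj (cnj \<eta> * E t ^ M + Q) ^ 2"
      using alg[OF \<eta>1 En[of M], of "g (of_real \<rho> * E t)" "cnj Q"]
      by (simp only: complex_cnj_add complex_cnj_mult complex_cnj_power complex_cnj_cnj)
    then have "norm (?F t) = norm (g (of_real \<rho> * E t)) * (norm (cnj \<eta> * E t ^ M + Q))\<^sup>2"
      by (simp only: norm_mult norm_power complex_mod_cnj \<eta> E1) simp
    also have "\<dots> \<le> C * (norm (cnj \<eta> * E t ^ M + Q))\<^sup>2"
      using \<rho> by (intro mult_right_mono C) (auto simp: norm_mult E1)
    finally show ?thesis unfolding qQ .
  qed
  have "norm (integral {0..1} ?F) \<le> integral {0..1} (\<lambda>t. C * (norm (\<Sum>i\<in>insert M {..n}. q i * E t ^ i))\<^sup>2)"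
    using F q bound by (intro integral_norm_bound_integral) auto
  then show ?thesis
    unfolding integral_unique[OF F] integral_unique[OF q] qs .
qed

text \<open>The test coefficients \<open>s i * b i\<close> turn the linear terms into squares, and
  the rotation \<open>\<eta>\<close> turns \<open>b M\<close> into its modulus. The bound
  \<open>1 / \<rho> ^ k\<close> for g on the circle comes from the bound on
  \<open>z ^ k * g z\<close> and tends to 1 as \<open>\<rho>\<close> tends to 1. The real part of
  the term with \<open>0 ^ d\<close>, which survives only for d = 0, is at least minus its
  modulus.\<close>

lemma coeff_inequality:
  fixes b :: "nat \<Rightarrow> complex" and s :: "nat \<Rightarrow> real"
  assumes g: "\<And>z. norm z < 1 \<Longrightarrow> (\<lambda>n. b n * z ^ n) sums g z"
    and le: "\<And>z. norm z < 1 \<Longrightarrow> norm (z ^ k * g z) \<le> 1"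
    and M: "M = 2 * n + d" "n < M"
  shows "norm (b M) + 2 * (\<Sum>i\<le>n. s i * (norm (b i))\<^sup>2) - 0 ^ d * norm (b 0) * (s n)\<^sup>2 * (norm (b n))\<^sup>2
         \<le> 1 + (\<Sum>i\<le>n. (s i)\<^sup>2 * (norm (b i))\<^sup>2)"
proof -
  obtain \<eta> where \<eta>: "norm \<eta> = 1" "\<eta> * b M = of_real (norm (b M))"
  proof
    let ?\<eta> = "if b M = 0 then 1 else cnj (sgn (b M))"
    show "norm ?\<eta> = 1" by (simp add: norm_sgn)
    show "?\<eta> * b M = of_real (norm (b M))"
      using complex_norm_square[of "b M"]
      by (simp add: sgn_eq field_simps power2_eq_square)
  qed
  define v where "v = (\<lambda>i. of_real (s i) * b i)"
  define F where "F = (\<lambda>\<rho>::real. \<eta> * (b M * of_real \<rho> ^ M) + (\<Sum>i\<le>n. 2 * cnj (v i) * (b i * of_real \<rho> ^ i)) + cnj \<eta> * (b 0 * 0 ^ d * cnj (v n) ^ 2))"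
  define S where "S = 1 + (\<Sum>i\<le>n. (norm (v i))\<^sup>2)"
  have ev: "eventually (\<lambda>\<rho>. norm (F \<rho>) \<le> 1 / \<rho> ^ k * S) (at_left 1)"
  proof (rule eventually_at_leftI[of 0])
    fix \<rho> :: real assume "\<rho> \<in> {0<..<1}"
    then have \<rho>: "0 < \<rho>" "\<rho> < 1" by auto
    show "norm (F \<rho>) \<le> 1 / \<rho> ^ k * S"
      unfolding F_def S_def
    proof (rule circle_coeff_inequality[OF g \<rho> _ M \<eta>(1)])
      fix z :: complex assume "norm z = \<rho>"
      then show "norm (g z) \<le> 1 / \<rho> ^ k"
        using le[of z] \<rho> by (simp add: norm_mult norm_power field_simps)
    qed auto
  qed auto
  have "((\<lambda>\<rho>. norm (F \<rho>)) \<longlongrightarrow> norm (F 1)) (at_left 1)"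
    unfolding F_def by (intro tendsto_intros)
  moreover have "((\<lambda>\<rho>. 1 / \<rho> ^ k * S) \<longlongrightarrow> 1 / 1 ^ k * S) (at_left 1)"
    by (intro tendsto_intros) auto
  ultimately have "norm (F 1) \<le> S"
    using tendsto_le[OF _ _ _ ev] by fastforce
  then have "Re (F 1) \<le> S" using complex_Re_le_cmod order_trans by blast
  moreover have "F 1 = of_real (norm (b M) + 2 * (\<Sum>i\<le>n. s i * (norm (b i))\<^sup>2)) + cnj \<eta> * (b 0 * 0 ^ d * cnj (v n) ^ 2)"
  proof -
    have "cnj (v i) * b i = of_real (s i * (norm (b i))\<^sup>2)" for i
      by (simp only: v_def complex_norm_square of_real_mult) (simp add: mult_ac)
    then show ?thesis
      by (simp add: F_def \<eta> sum_distrib_left mult.assoc)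
  qed
  moreover have "- Re (cnj \<eta> * (b 0 * 0 ^ d * cnj (v n) ^ 2)) \<le> 0 ^ d * norm (b 0) * (s n)\<^sup>2 * (norm (b n))\<^sup>2"
  proof -
    have "- Re w \<le> norm w" for w using complex_Re_le_cmod[of "- w"] by simp
    also have "norm (cnj \<eta> * (b 0 * 0 ^ d * cnj (v n) ^ 2)) = 0 ^ d * norm (b 0) * (s n)\<^sup>2 * (norm (b n))\<^sup>2"
      by (simp add: norm_mult norm_power \<eta> v_def power_mult_distrib)
    finally show ?thesis .
  qed
  moreover have "S = 1 + (\<Sum>i\<le>n. (s i)\<^sup>2 * (norm (b i))\<^sup>2)"
    by (simp add: S_def v_def norm_mult power_mult_distrib)
  ultimately show ?thesis by simp
qed

text \<open>With d = 1 the extra term vanishes, and unit weights leave 2 - 1 = 1 copy of each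
  square.\<close>

lemma Carlson_odd:
  fixes b :: "nat \<Rightarrow> complex"
  assumes "\<And>z. norm z < 1 \<Longrightarrow> (\<lambda>n. b n * z ^ n) sums g z"
    and "\<And>z. norm z < 1 \<Longrightarrow> norm (z ^ k * g z) \<le> 1"
  shows "norm (b (2 * n + 1)) \<le> 1 - (\<Sum>i\<le>n. (norm (b i))\<^sup>2)"
  using coeff_inequality[OF assms, of "2 * n + 1" n 1 "\<lambda>_. 1"] by simp

text \<open>With d = 0 the extra term falls on the last square, whose total weight becomes
  \<open>2 * s - (1 + norm (b 0)) * s\<^sup>2\<close>. This is largest at
  \<open>s = 1 / (1 + norm (b 0))\<close>, with that same value; the other weights are 1.\<close>

lemma Carlson_even:
  fixes b :: "nat \<Rightarrow> complex"
  assumes "\<And>z. norm z < 1 \<Longrightarrow> (\<lambda>n. b n * z ^ n) sums g z"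
    and "\<And>z. norm z < 1 \<Longrightarrow> norm (z ^ k * g z) \<le> 1"
    and "n > 0"
  shows "norm (b (2 * n)) \<le> 1 - (\<Sum>i<n. (norm (b i))\<^sup>2) - (norm (b n))\<^sup>2 / (1 + norm (b 0))"
proof -
  define s where "s = 1 / (1 + norm (b 0))"
  have "1 + norm (b 0) > 0" by (simp add: add_pos_nonneg)
  then have s: "s * (1 + norm (b 0)) = 1" by (simp add: s_def)
  have "2 * s * (norm (b n))\<^sup>2 - norm (b 0) * s\<^sup>2 * (norm (b n))\<^sup>2 - s\<^sup>2 * (norm (b n))\<^sup>2
      = (2 * s - s * (s * (1 + norm (b 0)))) * (norm (b n))\<^sup>2"
    by (simp add: power2_eq_square algebra_simps)
  also have "\<dots> = (norm (b n))\<^sup>2 / (1 + norm (b 0))"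
    unfolding s by (simp add: s_def)
  finally have *: "2 * s * (norm (b n))\<^sup>2 - norm (b 0) * s\<^sup>2 * (norm (b n))\<^sup>2 - s\<^sup>2 * (norm (b n))\<^sup>2
      = (norm (b n))\<^sup>2 / (1 + norm (b 0))" .
  have "{..n} = insert n {..<n}" by auto
  with coeff_inequality[OF assms(1,2), of "2 * n" n 0 "\<lambda>i. if i = n then s else 1"] * \<open>n > 0\<close>
  show ?thesis by simp
qed

section \<open>Summing the coefficient inequalities\<close>

text \<open>
  In \<open>\<Sum>c m * r^m\<close>, bounded termwise by Carlson's inequalities, the square \<open>(c j)\<^sup>2\<close> is subtracted with weight
  \<open>r^(2 j) / (1 + c 0)\<close> at \<open>m = 2 j\<close> and \<open>r^m\<close> for all \<open>m > 2 j\<close>; the total weight is exactly the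
  coefficient of the sum of squares.
\<close>
lemma weighted_partial_sum_le:
  fixes c :: "nat \<Rightarrow> real"
  assumes odd: "\<And>n. c (2 * n + 1) \<le> 1 - (\<Sum>i\<le>n. (c i)\<^sup>2)"
    and even: "\<And>n. n > 0 \<Longrightarrow> c (2 * n) \<le> 1 - (\<Sum>i<n. (c i)\<^sup>2) - (c n)\<^sup>2 / (1 + c 0)"
    and r: "0 \<le> r" "r < 1"
  shows "(\<Sum>m<2 * n + 2. c m * r ^ m)
           + (1 / (1 + c 0) + r / (1 - r)) * (\<Sum>j<n. (c (j + 1))\<^sup>2 * r ^ (2 * (j + 1)))
           + r ^ (2 * n + 2) / (1 - r) * (1 - (\<Sum>i\<le>n. (c i)\<^sup>2))
         \<le> c 0 + (1 - (c 0)\<^sup>2) * (r / (1 - r))"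
\<comment> \<open>The last summand on the left is a reserve for the terms not yet summed: the
  geometric tail from exponent 2n + 2 on, times the current slack in Carlson's inequalities.\<close>
proof (induction n)
  case 0
  have "c 1 * r \<le> (1 - (c 0)\<^sup>2) * r" using odd[of 0] r by (intro mult_right_mono) auto
  moreover have "(1 - (c 0)\<^sup>2) * r + r\<^sup>2 / (1 - r) * (1 - (c 0)\<^sup>2) = (1 - (c 0)\<^sup>2) * (r / (1 - r))"
    using r by (simp add: field_simps power2_eq_square)
  ultimately show ?case by (simp add: numeral_2_eq_2)
next
  case (Suc n)
  define W where "W = 1 - (\<Sum>i\<le>n. (c i)\<^sup>2)"
  define e where "e = (c (n + 1))\<^sup>2"
  define X where "X = r ^ (2 * n + 2)"
  have X0: "X \<ge> 0" "X * r \<ge> 0" using r by (auto simp: X_def)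
  have "c (2 * n + 2) * X \<le> (W - e / (1 + c 0)) * X"
    using even[of "n + 1"] by (intro mult_right_mono X0) (simp add: W_def e_def lessThan_Suc_atMost)
  moreover have "c (2 * n + 3) * (X * r) \<le> (W - e) * (X * r)"
    using odd[of "n + 1"] by (intro mult_right_mono X0) (simp add: W_def e_def eval_nat_numeral)
  \<comment> \<open>The old reserve \<open>X / (1 - r) * W\<close> pays exactly for the bounds at 2n
    + 2 and 2n + 3, the new square and the new reserve, so the left-hand side does not increase with
    n.\<close>
  moreover have "(W - e / (1 + c 0)) * X + (W - e) * (X * r) + (1 / (1 + c 0) + r / (1 - r)) * (e * X)
      + X * r\<^sup>2 / (1 - r) * (W - e) = X / (1 - r) * W"
  proof -
    have "1 / (1 + c 0) * (e * X) = e / (1 + c 0) * X" by simp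
    then have "(W - e / (1 + c 0)) * X + (1 / (1 + c 0) + r / (1 - r)) * (e * X) = W * X + r / (1 - r) * (e * X)"
      by (simp add: algebra_simps)
    moreover have "W * X + r / (1 - r) * (e * X) + (W - e) * (X * r) + X * r\<^sup>2 / (1 - r) * (W - e) = X / (1 - r) * W"
    proof -
      \<comment> \<open>In terms of \<open>q\<close> the denominators disappear and the identity
        becomes linear in \<open>q\<close>.\<close>
      define q where "q = r / (1 - r)"
      have q: "X * r\<^sup>2 / (1 - r) = X * (q - r)" "X / (1 - r) = X * (1 + q)"
        using r by (auto simp: q_def field_simps power2_eq_square)
      show ?thesis unfolding q q_def[symmetric] by (simp add: algebra_simps)
    qed
    ultimately show ?thesis by linarith
  qed
  moreover have "(\<Sum>m<2 * Suc n + 2. c m * r ^ m) = (\<Sum>m<2 * n + 2. c m * r ^ m) + c (2 * n + 2) * X + c (2 * n + 3) * (X * r)"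
    by (simp add: X_def eval_nat_numeral mult_ac)
  moreover have "(1 / (1 + c 0) + r / (1 - r)) * (\<Sum>j<Suc n. (c (j + 1))\<^sup>2 * r ^ (2 * (j + 1)))
     = (1 / (1 + c 0) + r / (1 - r)) * (\<Sum>j<n. (c (j + 1))\<^sup>2 * r ^ (2 * (j + 1))) + (1 / (1 + c 0) + r / (1 - r)) * (e * X)"
    by (simp add: X_def e_def distrib_left)
  moreover have "r ^ (2 * Suc n + 2) = X * r\<^sup>2" by (simp add: X_def power2_eq_square mult_ac)
  moreover have "1 - (\<Sum>i\<le>Suc n. (c i)\<^sup>2) = W - e" by (simp add: W_def e_def)
  ultimately show ?case using Suc.IH unfolding X_def[symmetric] W_def[symmetric] by simp
qed

text \<open>Taking out \<open>r ^ k\<close> passes from f to \<open>f z / z ^ k\<close>. The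
  exponents 2n - k and 2n + 1 - k differ by one factor r, which merges the two quadratic sums. Both
  series are dominated by the geometric series.\<close>

lemma bohr_lhs_eq:
  assumes c: "\<And>n. norm (a (n + k)) \<le> 1" and r: "0 \<le> r" "r < 1"
  shows "summable (\<lambda>n. norm (a (n + k)) * r ^ n)"
    and "summable (\<lambda>n. (norm (a (n + k + 1)))\<^sup>2 * r ^ (2 * (n + 1)))"
    and "bohr_lhs k a r = r ^ k * ((\<Sum>n. norm (a (n + k)) * r ^ n)
          + (1 / (1 + norm (a k)) + r / (1 - r)) * (\<Sum>n. (norm (a (n + k + 1)))\<^sup>2 * r ^ (2 * (n + 1))))"
proof -
  show s1: "summable (\<lambda>n. norm (a (n + k)) * r ^ n)"
    using r c by (intro summable_comparison_test'[OF summable_geometric[of r]]) (auto simp: mult_left_le_one_le)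
  show s2: "summable (\<lambda>n. (norm (a (n + k + 1)))\<^sup>2 * r ^ (2 * (n + 1)))"
  proof (rule summable_comparison_test'[OF summable_geometric[of r]])
    fix n
    have "r ^ (2 * (n + 1)) \<le> r ^ n" using r by (intro power_decreasing) auto
    moreover have "(norm (a (n + k + 1)))\<^sup>2 \<le> 1" using c[of "n + 1"] by (simp add: power_le_one)
    ultimately have "(norm (a (n + k + 1)))\<^sup>2 * r ^ (2 * (n + 1)) \<le> 1 * r ^ n"
      using r by (intro mult_mono) auto
    then show "norm ((norm (a (n + k + 1)))\<^sup>2 * r ^ (2 * (n + 1))) \<le> r ^ n" using r by simp
  qed (use r in auto)
  have e: "2 * (n + (k + 1)) - k = k + 2 * (n + 1)" "2 * (n + (k + 1)) + 1 - k = k + 1 + 2 * (n + 1)" for n by auto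
  have "(\<Sum>n. norm (a (n + k)) * r ^ (n + k)) = r ^ k * (\<Sum>n. norm (a (n + k)) * r ^ n)"
    by (subst suminf_mult[OF s1, symmetric]) (simp add: power_add mult_ac)
  moreover have "(\<Sum>n. (norm (a (n + (k + 1))))\<^sup>2 * r ^ (2 * (n + (k + 1)) - k))
      = r ^ k * (\<Sum>n. (norm (a (n + k + 1)))\<^sup>2 * r ^ (2 * (n + 1)))"
    unfolding e by (subst suminf_mult[OF s2, symmetric]) (simp add: power_add mult_ac)
  moreover have "(\<Sum>n. (norm (a (n + (k + 1))))\<^sup>2 * r ^ (2 * (n + (k + 1)) + 1 - k))
      = r ^ (k + 1) * (\<Sum>n. (norm (a (n + k + 1)))\<^sup>2 * r ^ (2 * (n + 1)))"
    unfolding e by (subst suminf_mult[OF s2, symmetric]) (simp add: power_add mult_ac)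
  ultimately show "bohr_lhs k a r = r ^ k * ((\<Sum>n. norm (a (n + k)) * r ^ n)
          + (1 / (1 + norm (a k)) + r / (1 - r)) * (\<Sum>n. (norm (a (n + k + 1)))\<^sup>2 * r ^ (2 * (n + 1))))"
    unfolding bohr_lhs_def by (simp add: algebra_simps)
qed

text \<open>The limit of \<open>weighted_partial_sum_le\<close>, with its nonnegative reserve
  dropped.\<close>

lemma bohr_lhs_le:
  assumes f: "f \<in> schur_class_vanishing k" and a: "expands_from k f a" and r: "0 \<le> r" "r < 1"
  shows "bohr_lhs k a r \<le> r ^ k * (norm (a k) + (1 - (norm (a k))\<^sup>2) * (r / (1 - r)))"
proof -
  define b where "b = (\<lambda>n. a (n + k))"
  define g where "g = (\<lambda>z. \<Sum>n. b n * z ^ n)"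
  define c where "c = (\<lambda>n. norm (b n))"
  have f_sums: "(\<lambda>n. b n * z ^ n * z ^ k) sums f z" if "norm z < 1" for z
    using a that by (simp add: expands_from_def b_def power_add mult.assoc)
  \<comment> \<open>Convergence for g is obtained by cancelling \<open>z ^ k\<close>, hence the
    separate case z = 0.\<close>
  have g: "(\<lambda>n. b n * z ^ n) sums g z" if "norm z < 1" for z
  proof (cases "z = 0")
    case True
    then show ?thesis using powser_sums_zero[of b] by (simp add: g_def sums_iff)
  next
    case False
    then have "summable (\<lambda>n. b n * z ^ n)"
      using sums_summable[OF f_sums[OF that]] summable_mult2[of "\<lambda>n. b n * z ^ n * z ^ k" "inverse (z ^ k)"]
      by (simp add: mult.assoc)
    then show ?thesis by (simp add: g_def summable_sums)
  qed
  have le: "norm (z ^ k * g z) \<le> 1" if "norm z < 1" for z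
  proof -
    have "f z = z ^ k * g z"
      using sums_unique2[OF f_sums[OF that] sums_mult2[OF g[OF that], of "z ^ k"]] by (simp add: mult.commute)
    moreover have "norm (f z) \<le> 1"
      using f that by (simp add: schur_class_vanishing_def schur_class_def)
    ultimately show ?thesis by simp
  qed
  have odd: "c (2 * n + 1) \<le> 1 - (\<Sum>i\<le>n. (c i)\<^sup>2)" for n
    unfolding c_def by (rule Carlson_odd[OF g le])
  have even: "c (2 * n) \<le> 1 - (\<Sum>i<n. (c i)\<^sup>2) - (c n)\<^sup>2 / (1 + c 0)" if "n > 0" for n
    unfolding c_def by (rule Carlson_even[OF g le that])
  \<comment> \<open>The left-hand side of the odd inequality is nonnegative. This gives the sign of
    the reserve and bounds every coefficient by 1.\<close>
  have W: "0 \<le> 1 - (\<Sum>i\<le>n. (c i)\<^sup>2)" for n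
    using odd[of n] norm_ge_zero[of "b (2 * n + 1)"] unfolding c_def by linarith
  have c1: "norm (a (n + k)) \<le> 1" for n
  proof -
    have "(c n)\<^sup>2 \<le> (\<Sum>i\<le>n. (c i)\<^sup>2)" by (intro member_le_sum) auto
    with W[of n] have "(c n)\<^sup>2 \<le> 1" by linarith
    then show ?thesis by (simp add: c_def b_def abs_square_le_1)
  qed
  note B = bohr_lhs_eq[of a k r, OF c1 r]
  let ?l = "1 / (1 + c 0) + r / (1 - r)"
  \<comment> \<open>The linear sum is cut off at 2n + 2 and the quadratic one at n, as in
    \<open>weighted_partial_sum_le\<close>; a subsequence of partial sums suffices for the
    limit.\<close>
  have "(\<lambda>n. (\<Sum>m<2 * n + 2. c m * r ^ m) + ?l * (\<Sum>j<n. (c (j + 1))\<^sup>2 * r ^ (2 * (j + 1))))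
     \<longlonglongrightarrow> (\<Sum>n. c n * r ^ n) + ?l * (\<Sum>n. (c (n + 1))\<^sup>2 * r ^ (2 * (n + 1)))"
  proof (intro tendsto_intros)
    have "(\<lambda>n. \<Sum>m<n. c m * r ^ m) \<longlonglongrightarrow> (\<Sum>n. c n * r ^ n)"
      using B(1) unfolding c_def b_def by (rule summable_LIMSEQ)
    moreover have "filterlim (\<lambda>n::nat. 2 * n + 2) sequentially sequentially"
      by (rule filterlim_subseq) (auto simp: strict_mono_def)
    ultimately show "(\<lambda>n. \<Sum>m<2 * n + 2. c m * r ^ m) \<longlonglongrightarrow> (\<Sum>n. c n * r ^ n)"
      by (rule filterlim_compose)
    show "(\<lambda>n. \<Sum>j<n. (c (j + 1))\<^sup>2 * r ^ (2 * (j + 1))) \<longlonglongrightarrow> (\<Sum>n. (c (n + 1))\<^sup>2 * r ^ (2 * (n + 1)))"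
      using B(2) unfolding c_def b_def by (intro summable_LIMSEQ) (simp add: add_ac)
  qed
  moreover have "(\<Sum>m<2 * n + 2. c m * r ^ m) + ?l * (\<Sum>j<n. (c (j + 1))\<^sup>2 * r ^ (2 * (j + 1)))
       \<le> c 0 + (1 - (c 0)\<^sup>2) * (r / (1 - r))" for n
  proof -
    have "0 \<le> r ^ (2 * n + 2) / (1 - r) * (1 - (\<Sum>i\<le>n. (c i)\<^sup>2))"
      using W r by (intro mult_nonneg_nonneg divide_nonneg_nonneg) auto
    then show ?thesis using weighted_partial_sum_le[of c r n, OF odd even r] by linarith
  qed
  ultimately have "(\<Sum>n. c n * r ^ n) + ?l * (\<Sum>n. (c (n + 1))\<^sup>2 * r ^ (2 * (n + 1)))
     \<le> c 0 + (1 - (c 0)\<^sup>2) * (r / (1 - r))"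
    by (intro LIMSEQ_le_const2) auto
  then have "r ^ k * ((\<Sum>n. c n * r ^ n) + ?l * (\<Sum>n. (c (n + 1))\<^sup>2 * r ^ (2 * (n + 1))))
     \<le> r ^ k * (c 0 + (1 - (c 0)\<^sup>2) * (r / (1 - r)))"
    using r by (intro mult_left_mono) auto
  then show ?thesis unfolding B(3) by (simp add: c_def b_def add_ac)
qed

section \<open>The extremal functions: disk automorphisms times a power of z\<close>

lemma extremal_function:
  fixes \<alpha> :: real
  assumes \<alpha>: "0 < \<alpha>" "\<alpha> < 1" and "k > 0"
  obtains f a where "f \<in> schur_class_vanishing k" "expands_from k f a"
    "\<And>r. 0 \<le> r \<Longrightarrow> r < 1 \<Longrightarrow> bohr_lhs k a r = r ^ k * (\<alpha> + (1 - \<alpha>\<^sup>2) * (r / (1 - r)))"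
proof
  define f where "f = (\<lambda>z::complex. z ^ k * ((\<alpha> - z) / (1 - \<alpha> * z)))"
  \<comment> \<open>The zeros below k make \<open>a\<close> the coefficient sequence of the full
    power series, from which analyticity and the vanishing derivatives are read off.\<close>
  define a :: "nat \<Rightarrow> complex" where
    "a = (\<lambda>n. if n < k then 0 else if n = k then of_real \<alpha> else - of_real ((1 - \<alpha>\<^sup>2) * \<alpha> ^ (n - k - 1)))"
  have a0: "a k = of_real \<alpha>" by (simp add: a_def)
  have aS: "a (n + k + 1) = - of_real ((1 - \<alpha>\<^sup>2) * \<alpha> ^ n)" for n by (simp add: a_def)
  have \<alpha>2: "0 < 1 - \<alpha>\<^sup>2" using \<alpha> by (simp add: power_less_one_iff)
  have naS: "norm (a (n + k + 1)) = (1 - \<alpha>\<^sup>2) * \<alpha> ^ n" for n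
    unfolding aS norm_minus_cancel norm_of_real using \<alpha> \<alpha>2 by simp
  have f: "(\<lambda>n. a (n + k) * z ^ (n + k)) sums f z" if "norm z < 1" for z
  proof -
    have n1: "norm (\<alpha> * z) < 1"
      using mult_strict_mono'[of \<alpha> 1 "norm z" 1] \<alpha> that by (simp add: norm_mult)
    then have ne: "1 - \<alpha> * z \<noteq> 0" by auto
    have "(\<lambda>n. - of_real (1 - \<alpha>\<^sup>2) * z ^ (k + 1) * (\<alpha> * z) ^ n) sums (- of_real (1 - \<alpha>\<^sup>2) * z ^ (k + 1) * (1 / (1 - \<alpha> * z)))"
      by (intro sums_mult geometric_sums n1)
    moreover have "- of_real (1 - \<alpha>\<^sup>2) * z ^ (k + 1) * (\<alpha> * z) ^ n = a (Suc n + k) * z ^ (Suc n + k)" for n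
    proof -
      have a: "a (Suc n + k) = - of_real (1 - \<alpha>\<^sup>2) * of_real \<alpha> ^ n" using aS[of n] by (simp add: algebra_simps)
      have "w * z ^ (k + 1) * (x * z) ^ n = w * x ^ n * z ^ (Suc n + k)" for w x
        by (simp add: power_mult_distrib power_add mult_ac)
      then show ?thesis unfolding a .
    qed
    ultimately have "(\<lambda>n. a (Suc n + k) * z ^ (Suc n + k)) sums (- of_real (1 - \<alpha>\<^sup>2) * z ^ (k + 1) * (1 / (1 - \<alpha> * z)))"
      by (simp only:)
    moreover have "- of_real (1 - \<alpha>\<^sup>2) * z ^ (k + 1) * (1 / (1 - \<alpha> * z)) = f z - a k * z ^ k"
      using ne by (simp add: f_def a0 field_simps power2_eq_square)
    ultimately show ?thesis
      using sums_Suc_iff[of "\<lambda>n. a (n + k) * z ^ (n + k)" "f z - a k * z ^ k"] by simp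
  qed
  then show "expands_from k f a" by (simp add: expands_from_def)
  have f': "(\<lambda>n. a n * z ^ n) sums f z" if "norm z < 1" for z
    using f[OF that] sums_zero_iff_shift[of k "\<lambda>n. a n * z ^ n" "f z"] by (simp add: a_def)
  have "f analytic_on ball 0 1"
    using power_series_analytic[of 0 1 a f] f' by simp
  moreover have "norm (f z) \<le> 1" if "norm z < 1" for z
  proof -
    have "norm ((z - \<alpha>) / (1 - \<alpha> * z)) < 1"
      using Moebius_function_norm_lt_1[of "of_real \<alpha>" z 0] \<alpha> that by (simp add: Moebius_function_simple)
    then have "norm ((\<alpha> - z) / (1 - \<alpha> * z)) \<le> 1"
      by (simp add: norm_divide norm_minus_commute)
    moreover have "norm (z ^ k) \<le> 1" using that by (simp add: norm_power power_le_one)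
    ultimately show ?thesis
      unfolding f_def norm_mult by (intro mult_le_one) auto
  qed
  moreover have "(deriv ^^ j) f 0 = 0" if "j < k" for j
    using higher_deriv_eq_coeff[OF f', where n = j] that by (simp add: a_def)
  ultimately show "f \<in> schur_class_vanishing k"
    by (auto simp: schur_class_vanishing_def schur_class_def)
  fix r :: real assume r: "0 \<le> r" "r < 1"
  have c1: "norm (a (n + k)) \<le> 1" for n
  proof (cases n)
    case 0
    then show ?thesis using \<alpha> by (simp add: a0)
  next
    case (Suc m)
    then have "norm (a (n + k)) = (1 - \<alpha>\<^sup>2) * \<alpha> ^ m" using naS[of m] by simp
    also have "\<dots> \<le> 1" using \<alpha> \<alpha>2 by (intro mult_le_one) (auto simp: power_le_one)
    finally show ?thesis .
  qed
  have ar: "0 \<le> \<alpha> * r" "\<alpha> * r < 1"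
    using mult_strict_mono'[of \<alpha> 1 r 1] \<alpha> r by auto
  have "(\<lambda>n. (1 - \<alpha>\<^sup>2) * r * (\<alpha> * r) ^ n) sums ((1 - \<alpha>\<^sup>2) * r * (1 / (1 - \<alpha> * r)))"
    using ar by (intro sums_mult geometric_sums) auto
  then have "(\<lambda>n. norm (a (Suc n + k)) * r ^ Suc n) sums ((1 - \<alpha>\<^sup>2) * r * (1 / (1 - \<alpha> * r)))"
    using naS by (simp add: power_mult_distrib mult_ac)
  then have S1: "(\<Sum>n. norm (a (n + k)) * r ^ n) = \<alpha> + (1 - \<alpha>\<^sup>2) * r / (1 - \<alpha> * r)"
    using \<alpha> by (subst (asm) sums_Suc_iff) (simp add: sums_iff a0)
  have ar2: "(\<alpha> * r)\<^sup>2 < 1" using ar by (simp add: power_less_one_iff)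
  have "(\<lambda>n. ((1 - \<alpha>\<^sup>2) * r)\<^sup>2 * ((\<alpha> * r)\<^sup>2) ^ n) sums (((1 - \<alpha>\<^sup>2) * r)\<^sup>2 * (1 / (1 - (\<alpha> * r)\<^sup>2)))"
    using ar2 by (intro sums_mult geometric_sums) auto
  moreover have "((1 - \<alpha>\<^sup>2) * r)\<^sup>2 * ((\<alpha> * r)\<^sup>2) ^ n = (norm (a (n + k + 1)))\<^sup>2 * r ^ (2 * (n + 1))" for n
    unfolding naS by (simp add: power_mult_distrib power2_eq_square power_mult power_add mult_ac)
  ultimately have S2: "(\<Sum>n. (norm (a (n + k + 1)))\<^sup>2 * r ^ (2 * (n + 1))) = ((1 - \<alpha>\<^sup>2) * r)\<^sup>2 / (1 - (\<alpha> * r)\<^sup>2)"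
    by (simp add: sums_iff)
  \<comment> \<open>The combined weight has numerator \<open>1 + \<alpha> * r\<close>, which cancels
    against \<open>1 - (\<alpha> * r)\<^sup>2\<close>. Adding the linear sum then removes
    \<open>1 - \<alpha> * r\<close> as well.\<close>
  have "(1 / (1 + \<alpha>) + r / (1 - r)) * (((1 - \<alpha>\<^sup>2) * r)\<^sup>2 / (1 - (\<alpha> * r)\<^sup>2))
      = (1 - \<alpha>\<^sup>2) * r * ((1 - \<alpha>) * r / ((1 - r) * (1 - \<alpha> * r)))"
  proof -
    have "1 / (1 + \<alpha>) + r / (1 - r) = (1 + \<alpha> * r) / ((1 + \<alpha>) * (1 - r))"
      using \<alpha> r by (simp add: divide_simps) (simp add: algebra_simps)
    moreover have "1 - (\<alpha> * r)\<^sup>2 = (1 + \<alpha> * r) * (1 - \<alpha> * r)" "1 - \<alpha>\<^sup>2 = (1 + \<alpha>) * (1 - \<alpha>)"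
      by (simp_all add: power2_eq_square algebra_simps)
    moreover have "1 + \<alpha> * r > 0" "1 - \<alpha> * r > 0" "1 + \<alpha> > 0" "1 - r > 0" using ar \<alpha> r by linarith+
    ultimately show ?thesis by (simp add: divide_simps power2_eq_square)
  qed
  moreover have "(1 - \<alpha>\<^sup>2) * r / (1 - \<alpha> * r) + (1 - \<alpha>\<^sup>2) * r * ((1 - \<alpha>) * r / ((1 - r) * (1 - \<alpha> * r)))
      = (1 - \<alpha>\<^sup>2) * (r / (1 - r))"
  proof -
    have "1 - \<alpha> * r \<noteq> 0" "1 - r \<noteq> 0" using ar r by auto
    then have "1 / (1 - \<alpha> * r) + (1 - \<alpha>) * r / ((1 - r) * (1 - \<alpha> * r)) = 1 / (1 - r)"
      by (simp add: divide_simps) (simp add: algebra_simps)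
    from arg_cong[OF this, of "\<lambda>x. (1 - \<alpha>\<^sup>2) * r * x"] show ?thesis by (simp add: distrib_left)
  qed
  ultimately show "bohr_lhs k a r = r ^ k * (\<alpha> + (1 - \<alpha>\<^sup>2) * (r / (1 - r)))"
    unfolding bohr_lhs_eq(3)[of a k r, OF c1 r] S1 S2 a0 using \<alpha> by simp
qed

section \<open>The majorant as a quadratic in t, and the root of the radius equation\<close>

text \<open>The defect is a single square: discarding it gives the upper bound, and choosing t to
  make it vanish gives sharpness.\<close>

lemma bohr_majorant_eq:
  fixes r t :: real
  assumes "k \<ge> 1" "r \<noteq> 1"
  shows "4 * (1 - r) * (r ^ k * (t + (1 - t\<^sup>2) * (r / (1 - r))))
         = r ^ (k - 1) * ((1 - 2 * r + 5 * r\<^sup>2) - (1 - r - 2 * r * t)\<^sup>2)"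
proof -
  have s: "(1 - r) * (r / (1 - r)) = r" using assms by simp
  have "4 * (1 - r) * (r * (t + (1 - t\<^sup>2) * (r / (1 - r))))
      = 4 * r * ((1 - r) * t + (1 - t\<^sup>2) * ((1 - r) * (r / (1 - r))))"
    by (simp only: distrib_left distrib_right mult_ac)
  also have "\<dots> = (1 - 2 * r + 5 * r\<^sup>2) - (1 - r - 2 * r * t)\<^sup>2"
    unfolding s by (simp add: power2_eq_square algebra_simps)
  finally have *: "4 * (1 - r) * (r * (t + (1 - t\<^sup>2) * (r / (1 - r)))) = (1 - 2 * r + 5 * r\<^sup>2) - (1 - r - 2 * r * t)\<^sup>2" .
  have "r ^ k = r ^ (k - 1) * r" using assms by (cases k) auto
  then have "4 * (1 - r) * (r ^ k * (t + (1 - t\<^sup>2) * (r / (1 - r))))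
      = r ^ (k - 1) * (4 * (1 - r) * (r * (t + (1 - t\<^sup>2) * (r / (1 - r)))))"
    by (simp only: mult_ac)
  then show ?thesis unfolding * .
qed

definition bohr_poly :: "nat \<Rightarrow> real \<Rightarrow> real" where
  "bohr_poly k r = 4 * (1 - r) - r ^ (k - 1) * (1 - 2 * r + 5 * r\<^sup>2)"

text \<open>\<open>4 * (1 - r)\<close> decreases strictly, and the subtracted product is
  nondecreasing for r >= 0. The quadratic factor alone decreases below 1/5; one factor r, available
  since k >= 2, restores monotonicity in \<open>\<phi>\<close>.\<close>

lemma bohr_poly_strict_decreasing:
  assumes "k \<ge> 2" "0 \<le> x" "x < y"
  shows "bohr_poly k y < bohr_poly k x"
proof -
  define \<phi> :: "real \<Rightarrow> real" where "\<phi> = (\<lambda>r. r * (1 - 2 * r + 5 * r\<^sup>2))"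
  have pos: "0 < 1 - 2 * r + 5 * r\<^sup>2" for r :: real
  proof -
    have "1 - 2 * r + 5 * r\<^sup>2 = (1 - r)\<^sup>2 + (2 * r)\<^sup>2" by (simp add: power2_eq_square algebra_simps)
    also have "\<dots> > 0" unfolding sum_power2_gt_zero_iff by auto
    finally show ?thesis .
  qed
  \<comment> \<open>The second factor is 1 - 2(x + y) + 5(x^2 + xy + y^2), split into terms that are
    nonnegative for x, y >= 0.\<close>
  have "\<phi> y - \<phi> x = (y - x) * ((1 - (x + y))\<^sup>2 + 3 * x\<^sup>2 + 3 * y\<^sup>2 + (x - y)\<^sup>2 + 5 * x * y)"
    by (simp add: \<phi>_def power2_eq_square algebra_simps)
  also have "\<dots> \<ge> 0"
    using assms by (intro mult_nonneg_nonneg add_nonneg_nonneg) auto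
  finally have "\<phi> x \<le> \<phi> y" by simp
  moreover have "x ^ (k - 2) \<le> y ^ (k - 2)" using assms by (intro power_mono) auto
  moreover have "0 \<le> \<phi> x" using assms pos[of x] by (simp add: \<phi>_def)
  ultimately have "x ^ (k - 2) * \<phi> x \<le> y ^ (k - 2) * \<phi> y"
    using assms by (intro mult_mono) auto
  moreover have "bohr_poly k r = 4 * (1 - r) - r ^ (k - 2) * \<phi> r" for r
  proof -
    have "k - 1 = Suc (k - 2)" using assms by simp
    then show ?thesis by (simp add: bohr_poly_def \<phi>_def)
  qed
  ultimately show ?thesis using assms by simp
qed

text \<open>The values 4 at 0 and -4 at 1 give existence, and strict monotonicity gives
  uniqueness.\<close>

lemma ex1_bohr_root:
  assumes "k \<ge> 2"
  shows "\<exists>!r. is_bohr_root k r"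
proof -
  have "\<exists>r\<ge>0. r \<le> 1 \<and> bohr_poly k r = 0"
    using assms by (intro IVT2) (auto simp: bohr_poly_def power_0_left intro!: continuous_intros)
  then obtain r where r: "0 \<le> r" "r \<le> 1" "bohr_poly k r = 0" by auto
  have "r \<noteq> 0" "r \<noteq> 1" using r(3) assms by (auto simp: bohr_poly_def power_0_left)
  with r have "is_bohr_root k r" by (auto simp: is_bohr_root_def bohr_poly_def)
  moreover have "s = t" if "is_bohr_root k s" "is_bohr_root k t" for s t
    using that bohr_poly_strict_decreasing[OF assms, of s t] bohr_poly_strict_decreasing[OF assms, of t s]
    by (cases s t rule: linorder_cases) (auto simp: is_bohr_root_def bohr_poly_def)
  ultimately show ?thesis by blast
qed

lemma bohr_radius_props:
  assumes "k \<ge> 2"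
  shows "1 / 3 < bohr_radius k" "bohr_radius k < 1" "bohr_poly k (bohr_radius k) = 0"
proof -
  have root: "is_bohr_root k (bohr_radius k)"
    unfolding bohr_radius_def by (rule theI'[OF ex1_bohr_root[OF assms]])
  then show "bohr_radius k < 1" and *: "bohr_poly k (bohr_radius k) = 0"
    by (auto simp: is_bohr_root_def bohr_poly_def)
  \<comment> \<open>At 1/3 the polynomial equals 8/3 - (8/9) (1/3)^(k-1), which is positive, so its
    zero lies further right.\<close>
  have "(1 / 3 :: real) ^ (k - 1) \<le> 1" by (intro power_le_one) auto
  then have "bohr_poly k (1 / 3) > 0" by (simp add: bohr_poly_def power2_eq_square)
  then have "bohr_radius k \<noteq> 1 / 3" using * by (metis less_irrefl)
  moreover have "\<not> bohr_radius k < 1 / 3"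
    using \<open>bohr_poly k (1 / 3) > 0\<close> * bohr_poly_strict_decreasing[OF assms, of "bohr_radius k" "1 / 3"] root
    by (auto simp: is_bohr_root_def)
  ultimately show "1 / 3 < bohr_radius k" by simp
qed

theorem theorem1:
  fixes k :: nat
  assumes "k \<ge> 2"
  shows "(\<exists>!r. is_bohr_root k r)
    \<and> (\<forall>f a r. f \<in> schur_class_vanishing k \<longrightarrow> expands_from k f a \<longrightarrow>
          r \<in> {0..bohr_radius k} \<longrightarrow> bohr_lhs k a r \<le> 1)
    \<and> (\<forall>R\<in>{bohr_radius k<..<1}. \<exists>f a r. f \<in> schur_class_vanishing k \<and> expands_from k f a \<and>
          r \<in> {0..R} \<and> \<not> bohr_lhs k a r \<le> 1)"
proof (intro conjI allI impI ballI)
  show "\<exists>!r. is_bohr_root k r" by (rule ex1_bohr_root[OF assms])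
next
  fix f a r
  assume f: "f \<in> schur_class_vanishing k" "expands_from k f a" and "r \<in> {0..bohr_radius k}"
  then have r: "0 \<le> r" "r \<le> bohr_radius k" "r < 1" using bohr_radius_props[OF assms] by auto
  define t where "t = norm (a k)"
  let ?B = "r ^ k * (t + (1 - t\<^sup>2) * (r / (1 - r)))"
  have "4 * (1 - r) * ?B = r ^ (k - 1) * ((1 - 2 * r + 5 * r\<^sup>2) - (1 - r - 2 * r * t)\<^sup>2)"
    using assms r by (intro bohr_majorant_eq) auto
  also have "\<dots> \<le> r ^ (k - 1) * (1 - 2 * r + 5 * r\<^sup>2)"
    using r by (intro mult_left_mono) auto
  also have "\<dots> \<le> 4 * (1 - r)"
    using bohr_poly_strict_decreasing[OF assms r(1), of "bohr_radius k"] r(2) bohr_radius_props(3)[OF assms]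
    by (cases "r = bohr_radius k") (auto simp: bohr_poly_def)
  finally have "?B \<le> 1" using r by simp
  then show "bohr_lhs k a r \<le> 1"
    using bohr_lhs_le[OF f r(1,3)] unfolding t_def by linarith
next
  fix R assume "R \<in> {bohr_radius k<..<1}"
  then have R: "bohr_radius k < R" "1 / 3 < R" "R < 1" using bohr_radius_props[OF assms] by auto
  \<comment> \<open>This is the t that annuls the square at r = R, and it is below 1 because R >
    1/3. The failing radius is R itself, where \<open>bohr_poly\<close> is already negative.\<close>
  define \<alpha> where "\<alpha> = (1 - R) / (2 * R)"
  have "0 < \<alpha>" "\<alpha> < 1" using R by (auto simp: \<alpha>_def field_simps)
  then obtain f a where f: "f \<in> schur_class_vanishing k" "expands_from k f a"
    and lhs: "\<And>r. 0 \<le> r \<Longrightarrow> r < 1 \<Longrightarrow> bohr_lhs k a r = r ^ k * (\<alpha> + (1 - \<alpha>\<^sup>2) * (r / (1 - r)))"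
    using extremal_function[of \<alpha> k] assms by auto
  have "1 - R - 2 * R * \<alpha> = 0" using R by (simp add: \<alpha>_def)
  then have "4 * (1 - R) * bohr_lhs k a R = R ^ (k - 1) * (1 - 2 * R + 5 * R\<^sup>2)"
    using bohr_majorant_eq[of k R \<alpha>] lhs[of R] assms R by simp
  moreover have "bohr_poly k R < 0"
    using bohr_poly_strict_decreasing[OF assms _ R(1)] bohr_radius_props[OF assms] by simp
  ultimately have "4 * (1 - R) * 1 < 4 * (1 - R) * bohr_lhs k a R"
    by (simp add: bohr_poly_def)
  then have "\<not> bohr_lhs k a R \<le> 1" using R by simp
  then show "\<exists>f a r. f \<in> schur_class_vanishing k \<and> expands_from k f a \<and> r \<in> {0..R} \<and> \<not> bohr_lhs k a r \<le> 1"
    using f R by (intro exI[of _ f] exI[of _ a] exI[of _ R]) auto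
qed

end
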